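(* Solutions to the Dirichlet problem for the minimal surface equation in the Heisenberg group need not be unique: there exist a region $\Omega\subset\mathbb{R}^2$ bounded by a closed curve $\gamma$ and a function $\varphi:\gamma\to\mathbb{R}$, whose graph $\Gamma=\{(x,y,\varphi(x,y)):(x,y)\in\gamma\}\subset H$ is a closed $C^2$ curve, for which there are two distinct functions $u_1\ne u_2$ on $\overline{\Omega}$, each of which solves $$H_{cc}(u)=0\ \text{ in }\Omega,\qquad u|_\gamma=\varphi .$$
   Context: $H$ is the three-dimensional Heisenberg group, identified with $\mathbb{R}^3$ with the left-invariant vector fields $X=\partial_x-y\partial_z$, $Y=\partial_y+x\partial_z$, $Z=2\partial_z$. The horizontal gradient is $\nabla_0F=(XF,YF)$, and $\nabla_0\cdot(a,b)=Xa+Yb$. For a function $u(x,y)$, with $F(x,y,z)=u(x,y)-z$, the operator is $$H_{cc}(u)=\nabla_0\cdot\frac{\nabla_0F}{|\nabla_0F|}=\partial_x\frac{p}{\sqrt{p^2+q^2}}+\partial_y\frac{q}{\sqrt{p^2+q^2}},\qquad p=u_x-y,\ q=u_y+x .$$ The expression $H_{cc}(u)$ makes sense at points where $\nabla_0F\neq0$; points where $\nabla_0F=0$ are called characteristic points of the graph, and for smooth $u$ the equation $H_{cc}(u)=0$ is understood at the non-characteristic points. *)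

theory Defs
  imports "HOL-Analysis.Analysis"
begin

type_synonym plane = "real \<times> real"

text \<open>The Heisenberg group in the coordinates (x, y, z).\<close>
type_synonym heis = "real \<times> real \<times> real"

definition X_field :: "(heis \<Rightarrow> real) \<Rightarrow> heis \<Rightarrow> real" where
  "X_field F = (\<lambda>(x, y, z). deriv (\<lambda>s. F (s, y, z)) x - y * deriv (\<lambda>s. F (x, y, s)) z)"

definition Y_field :: "(heis \<Rightarrow> real) \<Rightarrow> heis \<Rightarrow> real" where
  "Y_field F = (\<lambda>(x, y, z). deriv (\<lambda>s. F (x, s, z)) y + x * deriv (\<lambda>s. F (x, y, s)) z)"

definition hor_grad :: "(heis \<Rightarrow> real) \<Rightarrow> heis \<Rightarrow> real \<times> real" where
  "hor_grad F v = (X_field F v, Y_field F v)"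

definition hor_div :: "(heis \<Rightarrow> real \<times> real) \<Rightarrow> heis \<Rightarrow> real" where
  "hor_div W v = X_field (\<lambda>w. fst (W w)) v + Y_field (\<lambda>w. snd (W w)) v"

definition graph_fun :: "(plane \<Rightarrow> real) \<Rightarrow> heis \<Rightarrow> real" where
  "graph_fun u = (\<lambda>(x, y, z). u (x, y) - z)"

text \<open>Neither \<open>hor_grad (graph_fun u)\<close> nor the divergence below depends on \<open>z\<close>; they are
  evaluated at the point of the graph over \<open>(x, y)\<close>.  The norm on pairs is the Euclidean one.\<close>

definition lift :: "(plane \<Rightarrow> real) \<Rightarrow> plane \<Rightarrow> heis" where
  "lift u = (\<lambda>(x, y). (x, y, u (x, y)))"

definition characteristic :: "(plane \<Rightarrow> real) \<Rightarrow> plane \<Rightarrow> bool" where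
  "characteristic u P \<longleftrightarrow> hor_grad (graph_fun u) (lift u P) = 0"

definition H_cc :: "(plane \<Rightarrow> real) \<Rightarrow> plane \<Rightarrow> real" where
  "H_cc u P = hor_div (\<lambda>v. hor_grad (graph_fun u) v /\<^sub>R norm (hor_grad (graph_fun u) v)) (lift u P)"

definition minimal_surface_eq :: "(plane \<Rightarrow> real) \<Rightarrow> plane \<Rightarrow> bool" where
  "minimal_surface_eq u P \<longleftrightarrow> (\<not> characteristic u P \<longrightarrow> H_cc u P = 0)"

text \<open>For smooth \<open>u\<close> the fields above give \<open>hor_grad (graph_fun u) = (u_x + y, u_y - x)\<close>,
  whereas the planar form of the operator is customarily written with \<open>p = u_x - y\<close> and
  \<open>q = u_y + x\<close>.  The two differ by the orientation of the \<open>z\<close>-axis: replacing \<open>u\<close> by \<open>- u\<close>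
  turns one equation into the other.  The planar form is defined separately, with its own
  characteristic points, so that statements can be made for both sign conventions.\<close>

definition p_coord :: "(plane \<Rightarrow> real) \<Rightarrow> plane \<Rightarrow> real" where
  "p_coord u = (\<lambda>(x, y). deriv (\<lambda>s. u (s, y)) x - y)"

definition q_coord :: "(plane \<Rightarrow> real) \<Rightarrow> plane \<Rightarrow> real" where
  "q_coord u = (\<lambda>(x, y). deriv (\<lambda>s. u (x, s)) y + x)"

definition H_cc_planar :: "(plane \<Rightarrow> real) \<Rightarrow> plane \<Rightarrow> real" where
  "H_cc_planar u = (\<lambda>(x, y).
     deriv (\<lambda>s. p_coord u (s, y) / sqrt ((p_coord u (s, y))\<^sup>2 + (q_coord u (s, y))\<^sup>2)) x +
     deriv (\<lambda>s. q_coord u (x, s) / sqrt ((p_coord u (x, s))\<^sup>2 + (q_coord u (x, s))\<^sup>2)) y)"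

definition minimal_surface_eq_planar :: "(plane \<Rightarrow> real) \<Rightarrow> plane \<Rightarrow> bool" where
  "minimal_surface_eq_planar u P \<longleftrightarrow>
     ((p_coord u P, q_coord u P) \<noteq> (0, 0) \<longrightarrow> H_cc_planar u P = 0)"

primrec Ck_on :: "nat \<Rightarrow> plane set \<Rightarrow> (plane \<Rightarrow> real) \<Rightarrow> bool" where
  "Ck_on 0 S f \<longleftrightarrow> continuous_on S f"
| "Ck_on (Suc k) S f \<longleftrightarrow> (\<exists>fx fy.
     (\<forall>P\<in>S. (f has_derivative (\<lambda>h. fst h * fx P + snd h * fy P)) (at P)) \<and>
     Ck_on k S fx \<and> Ck_on k S fy)"

definition smooth_on :: "plane set \<Rightarrow> (plane \<Rightarrow> real) \<Rightarrow> bool" where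
  "smooth_on S f \<longleftrightarrow> (\<forall>k. Ck_on k S f)"

text \<open>A point set traced out once by a regular \<open>C\<^sup>2\<close> parametrization.  The parametrization is
  periodic on the whole line, so the \<open>C\<^sup>2\<close> condition also holds where the curve closes up.\<close>

definition closed_C2_curve :: "'a::real_normed_vector set \<Rightarrow> bool" where
  "closed_C2_curve \<Gamma> \<longleftrightarrow> (\<exists>c c' c''.
     range c = \<Gamma> \<and> (\<forall>t::real. c (t + 1) = c t) \<and> inj_on c {0..<1} \<and>
     (\<forall>t. (c has_vector_derivative c' t) (at t)) \<and>
     (\<forall>t. (c' has_vector_derivative c'' t) (at t)) \<and>
     continuous_on UNIV c'' \<and> (\<forall>t. c' t \<noteq> 0))"

definition simple_closed_curve :: "'a::topological_space set \<Rightarrow> bool" where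
  "simple_closed_curve \<gamma> \<longleftrightarrow>
     (\<exists>g. simple_path g \<and> pathfinish g = pathstart g \<and> path_image g = \<gamma>)"

definition region_bounded_by :: "plane set \<Rightarrow> plane set \<Rightarrow> bool" where
  "region_bounded_by \<Omega> \<gamma> \<longleftrightarrow> open \<Omega> \<and> connected \<Omega> \<and> bounded \<Omega> \<and> \<Omega> \<noteq> {} \<and>
     simple_closed_curve \<gamma> \<and> frontier \<Omega> = \<gamma>"

definition solves_dirichlet ::
  "((plane \<Rightarrow> real) \<Rightarrow> plane \<Rightarrow> bool) \<Rightarrow> plane set \<Rightarrow> plane set \<Rightarrow> (plane \<Rightarrow> real) \<Rightarrow> (plane \<Rightarrow> real) \<Rightarrow> bool"
  where
  "solves_dirichlet eqn \<Omega> \<gamma> \<phi> u \<longleftrightarrow>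
     smooth_on \<Omega> u \<and> continuous_on (closure \<Omega>) u \<and>
     (\<forall>P\<in>\<Omega>. eqn u P) \<and> (\<forall>P\<in>\<gamma>. u P = \<phi> P)"

end

theory Submission imports Defs begin

text \<open>If the horizontal gradient of \<open>u\<close> is everywhere parallel to one fixed vector, its direction
  is locally constant away from the characteristic points, so \<open>u\<close> solves the equation.  In the planar
  convention \<open>x y + y\<^sup>2\<close> and \<open>x y - x\<^sup>2 + 1\<close> are of this kind, with \<open>(p, q)\<close> equal to
  \<open>(2 x + 2 y) (0, 1)\<close> and \<open>2 x (- 1, 1)\<close>.  They agree exactly on the unit circle.  For the other
  sign convention both functions are negated.\<close>

definition quad :: "real \<Rightarrow> real \<Rightarrow> real \<Rightarrow> real \<Rightarrow> plane \<Rightarrow> real" where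
  "quad \<alpha> \<beta> \<gamma> \<delta> = (\<lambda>(x, y). \<alpha> * x\<^sup>2 + \<beta> * x * y + \<gamma> * y\<^sup>2 + \<delta>)"

text \<open>Only constants need induction on \<open>k\<close>: the partial derivatives of a
  quadratic are linear and those of a linear function constant, so a case distinction suffices
  there.\<close>

lemma smooth_on_quad: "smooth_on S (quad \<alpha> \<beta> \<gamma> \<delta>)"
proof -
  have const: "Ck_on k S (\<lambda>P. c)" for k and c :: real
  proof (induction k arbitrary: c)
    case (Suc k)
    show ?case
      unfolding Ck_on.simps
      by (rule exI[of _ "\<lambda>P. 0"], rule exI[of _ "\<lambda>P. 0"]) (simp add: Suc)
  qed simp
  have linear: "Ck_on k S (\<lambda>P. a * fst P + b * snd P)" for k and a b :: real
  proof (cases k)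
    case 0
    then show ?thesis by (auto intro!: continuous_intros)
  next
    case (Suc j)
    show ?thesis
      unfolding Suc Ck_on.simps
      by (rule exI[of _ "\<lambda>P. a"], rule exI[of _ "\<lambda>P. b"])
        (auto simp: const mult.commute intro!: derivative_eq_intros)
  qed
  have "Ck_on k S (quad \<alpha> \<beta> \<gamma> \<delta>)" for k
  proof (cases k)
    case 0
    then show ?thesis by (auto simp: quad_def case_prod_beta intro!: continuous_intros)
  next
    case (Suc j)
    show ?thesis
      unfolding Suc Ck_on.simps
      by (rule exI[of _ "\<lambda>P. 2 * \<alpha> * fst P + \<beta> * snd P"], rule exI[of _ "\<lambda>P. \<beta> * fst P + 2 * \<gamma> * snd P"])
        (intro conjI ballI linear;
          auto simp: quad_def case_prod_beta algebra_simps intro!: derivative_eq_intros)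
  qed
  then show ?thesis by (simp add: smooth_on_def)
qed

lemma continuous_on_quad: "continuous_on S (quad \<alpha> \<beta> \<gamma> \<delta>)"
  using smooth_on_quad[of S] Ck_on.simps(1) unfolding smooth_on_def by blast

text \<open>The subtracted \<open>c\<close> lets one lemma serve both conventions: it is
  \<open>z\<close> for \<open>graph_fun\<close> and \<open>0\<close> for the planar
  coordinates.\<close>

lemma deriv_quad:
  "deriv (\<lambda>s. quad \<alpha> \<beta> \<gamma> \<delta> (s, y) - c) x = 2 * \<alpha> * x + \<beta> * y"
  "deriv (\<lambda>s. quad \<alpha> \<beta> \<gamma> \<delta> (x, s) - c) y = \<beta> * x + 2 * \<gamma> * y"
  unfolding quad_def by (auto intro!: DERIV_imp_deriv derivative_eq_intros)

text \<open>By continuity the sign of \<open>f\<close> is constant near \<open>x\<close>. Each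
  component of a normalized gradient of fixed direction has this form.\<close>

lemma deriv_sgn_mult:
  fixes f :: "real \<Rightarrow> real"
  assumes "isCont f x" "f x \<noteq> 0"
  shows "deriv (\<lambda>s. sgn (f s) * c) x = 0"
proof -
  have "eventually (\<lambda>s. sgn (f s) = sgn (f x)) (nhds x)"
  proof (cases "f x > 0")
    case True
    then have "eventually (\<lambda>s. f s > 0) (nhds x)"
      using assms(1) by (metis isCont_def order_tendstoD(1) tendsto_at_iff_tendsto_nhds)
    then show ?thesis using True by (auto elim: eventually_mono)
  next
    case False
    then have neg: "f x < 0" using assms(2) by simp
    then have "eventually (\<lambda>s. f s < 0) (nhds x)"
      using assms(1) by (metis isCont_def order_tendstoD(2) tendsto_at_iff_tendsto_nhds)
    then show ?thesis using neg by (auto elim: eventually_mono)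
  qed
  then have "deriv (\<lambda>s. sgn (f s) * c) x = deriv (\<lambda>s. sgn (f x) * c) x"
    by (intro deriv_cong_ev) (auto elim: eventually_mono)
  then show ?thesis by simp
qed

text \<open>The map from \<open>(x, y)\<close> to \<open>(p, q)\<close> is linear, and the
  hypotheses factor its matrix as the rank-one product of the column \<open>(a, b)\<close> and the
  row \<open>(l, m)\<close>. The normalized field is then a fixed vector times the sign of
  \<open>l * x + m * y\<close>.\<close>

lemma minimal_surface_eq_planar_quad:
  assumes "2 * \<alpha> = a * l" "\<beta> - 1 = a * m" "\<beta> + 1 = b * l" "2 * \<gamma> = b * m"
  shows "minimal_surface_eq_planar (quad \<alpha> \<beta> \<gamma> \<delta>) P"
proof -
  let ?u = "quad \<alpha> \<beta> \<gamma> \<delta>" and ?N = "sqrt (a\<^sup>2 + b\<^sup>2)"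
  obtain x y where P: "P = (x, y)" by fastforce
  have p: "p_coord ?u (x, y) = a * (l * x + m * y)" for x y
  proof -
    have "p_coord ?u (x, y) = 2 * \<alpha> * x + (\<beta> - 1) * y"
      using deriv_quad(1)[of \<alpha> \<beta> \<gamma> \<delta> y 0 x] by (simp add: p_coord_def algebra_simps)
    then show ?thesis unfolding assms by (simp add: algebra_simps)
  qed
  have q: "q_coord ?u (x, y) = b * (l * x + m * y)" for x y
  proof -
    have "q_coord ?u (x, y) = (\<beta> + 1) * x + 2 * \<gamma> * y"
      using deriv_quad(2)[of \<alpha> \<beta> \<gamma> \<delta> x 0 y] by (simp add: q_coord_def algebra_simps)
    then show ?thesis unfolding assms by (simp add: algebra_simps)
  qed
  \<comment> \<open>This includes \<open>t = 0\<close>, where division by zero and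
    \<open>sgn 0\<close> both give 0, so the integrand of each derivative can be rewritten for all
    arguments at once.\<close>
  have dir: "e * t / sqrt ((a * t)\<^sup>2 + (b * t)\<^sup>2) = sgn t * (e / ?N)" for e t
  proof -
    have "sqrt ((a * t)\<^sup>2 + (b * t)\<^sup>2) = ?N * \<bar>t\<bar>"
      by (simp add: power_mult_distrib real_sqrt_mult flip: distrib_right)
    then show ?thesis by (simp add: sgn_real_def)
  qed
  \<comment> \<open>Dropping \<open>times_divide_eq_right\<close> keeps the quotient
    \<open>e / ?N\<close> apart as the constant factor that \<open>deriv_sgn_mult\<close>
    expects.\<close>
  have "H_cc_planar ?u (x, y) = 0" if "l * x + m * y \<noteq> 0"
    using that unfolding H_cc_planar_def prod.case p q dir
    by (simp add: deriv_sgn_mult del: times_divide_eq_right)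
  \<comment> \<open>On the line \<open>l * x + m * y = 0\<close> both coordinates vanish, so its
    points are characteristic.\<close>
  then show ?thesis
    unfolding minimal_surface_eq_planar_def P p q by auto
qed

text \<open>The same factorization for \<open>(u_x + y, u_y - x)\<close>: the
  \<open>z\<close>-derivative of \<open>u - z\<close> is \<open>- 1\<close>, which exchanges
  \<open>\<beta> - 1\<close> and \<open>\<beta> + 1\<close> in the matrix.\<close>

lemma minimal_surface_eq_quad:
  assumes "2 * \<alpha> = a * l" "\<beta> + 1 = a * m" "\<beta> - 1 = b * l" "2 * \<gamma> = b * m"
  shows "minimal_surface_eq (quad \<alpha> \<beta> \<gamma> \<delta>) P"
proof -
  let ?u = "quad \<alpha> \<beta> \<gamma> \<delta>"
  obtain x y where P: "P = (x, y)" by fastforce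
  have z: "deriv (\<lambda>s. c - s) t = - 1" for c t :: real
    by (auto intro!: DERIV_imp_deriv derivative_eq_intros)
  have grad: "hor_grad (graph_fun ?u) (x, y, z) = (l * x + m * y) *\<^sub>R (a, b)" for x y z
  proof -
    have "X_field (graph_fun ?u) (x, y, z) = 2 * \<alpha> * x + (\<beta> + 1) * y"
      by (simp add: X_field_def graph_fun_def deriv_quad z algebra_simps)
    moreover have "Y_field (graph_fun ?u) (x, y, z) = (\<beta> - 1) * x + 2 * \<gamma> * y"
      by (simp add: Y_field_def graph_fun_def deriv_quad z algebra_simps)
    ultimately show ?thesis unfolding hor_grad_def assms by (simp add: algebra_simps)
  qed
  have dir: "(t *\<^sub>R (a, b)) /\<^sub>R norm (t *\<^sub>R (a, b)) = sgn t *\<^sub>R sgn (a, b)" for t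
    by (metis sgn_div_norm sgn_scaleR)
  have "H_cc ?u (x, y) = 0" if "l * x + m * y \<noteq> 0"
    using that unfolding H_cc_def hor_div_def lift_def prod.case X_field_def Y_field_def grad dir
    by (simp add: deriv_sgn_mult)
  then show ?thesis
    unfolding minimal_surface_eq_def characteristic_def P lift_def prod.case grad by (auto simp: zero_prod_def)
qed

text \<open>Scaled to period 1, to fit both paths on the unit interval and
  \<open>closed_C2_curve\<close>.\<close>

definition circ :: "real \<Rightarrow> plane" where
  "circ t = (cos (2 * pi * t), sin (2 * pi * t))"

lemma in_sphere_plane: "(x, y) \<in> sphere (0 :: plane) 1 \<longleftrightarrow> x\<^sup>2 + y\<^sup>2 = 1"
  by (simp add: norm_Pair)

lemma circ_add_1: "circ (t + 1) = circ t"
  by (simp add: circ_def distrib_left)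

lemma inj_on_circ: "inj_on circ {0..<1}"
proof (rule inj_onI)
  fix s t :: real
  assume st: "s \<in> {0..<1}" "t \<in> {0..<1}" "circ s = circ t"
  then obtain n :: int where "2 * pi * s = 2 * pi * t + 2 * pi * n"
    using sin_cos_eq_iff[of "2 * pi * s" "2 * pi * t"] by (auto simp: circ_def)
  then have "2 * pi * s = 2 * pi * (t + n)" by (simp add: distrib_left)
  then have n: "s = t + n" by simp
  with st have "- 1 < real_of_int n" "real_of_int n < 1" by auto
  then have "n = 0" by linarith
  with n show "s = t" by simp
qed

lemma image_circ: "circ ` {0..1} = sphere 0 1"
proof
  show "circ ` {0..1} \<subseteq> sphere 0 1"
    by (auto simp: circ_def norm_Pair)
  show "sphere 0 1 \<subseteq> circ ` {0..1}"
  proof clarify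
    fix x y :: real
    assume "(x, y) \<in> sphere 0 1"
    then obtain t where t: "0 \<le> t" "t < 2 * pi" "x = cos t" "y = sin t"
      using sincos_total_2pi in_sphere_plane by metis
    then show "(x, y) \<in> circ ` {0..1}"
      by (intro image_eqI[of _ _ "t / (2 * pi)"]) (auto simp: circ_def)
  qed
qed

lemma range_circ: "range circ = sphere 0 1"
proof
  show "range circ \<subseteq> sphere 0 1"
    by (auto simp: circ_def norm_Pair)
qed (use image_circ in auto)

lemma region_bounded_by_circle: "region_bounded_by (ball 0 1) (sphere 0 1)"
proof -
  have "simple_path circ"
    unfolding simple_path_def loop_free_def path_def
  proof (intro conjI ballI impI)
    show "continuous_on {0..1} circ"
      unfolding circ_def by (intro continuous_intros)
  next
    fix s t :: real
    assume st: "s \<in> {0..1}" "t \<in> {0..1}" "circ s = circ t"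
    \<comment> \<open>A parameter equal to 1 is traded for 0, which leads back to the half-open
      interval where \<open>circ\<close> is injective.\<close>
    have "circ 1 = circ 0" using circ_add_1[of 0] by simp
    then show "s = t \<or> s = 0 \<and> t = 1 \<or> s = 1 \<and> t = 0"
      using st inj_onD[OF inj_on_circ, of s t] inj_onD[OF inj_on_circ, of s 0]
        inj_onD[OF inj_on_circ, of 0 t] by (cases "s = 1"; cases "t = 1") auto
  qed
  then have "simple_closed_curve (sphere (0 :: plane) 1)"
    unfolding simple_closed_curve_def path_image_def pathstart_def pathfinish_def
    using circ_add_1[of 0] image_circ by (intro exI[of _ circ]) simp
  then show ?thesis
    by (simp add: region_bounded_by_def)
qed

lemma closed_C2_curve_quad_over_circle:
  "closed_C2_curve {(x, y, quad \<alpha> \<beta> \<gamma> \<delta> (x, y)) | x y. (x, y) \<in> sphere 0 1}"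
proof -
  let ?C = "\<lambda>t. cos (2 * pi * t)" and ?S = "\<lambda>t. sin (2 * pi * t)"
  define c where "c t = (?C t, ?S t, quad \<alpha> \<beta> \<gamma> \<delta> (?C t, ?S t))" for t
  \<comment> \<open>In the last component \<open>\<alpha>\<close> and \<open>\<gamma>\<close> enter
    only through their difference, since the derivatives of the squared cosine and the squared sine
    are opposite.\<close>
  define c' where "c' t = (- (2 * pi) * ?S t, 2 * pi * ?C t,
      2 * pi * (2 * (\<gamma> - \<alpha>) * ?S t * ?C t + \<beta> * ((?C t)\<^sup>2 - (?S t)\<^sup>2)))" for t
  define c'' where "c'' t = (- (2 * pi)\<^sup>2 * ?C t, - (2 * pi)\<^sup>2 * ?S t,
      (2 * pi)\<^sup>2 * (2 * (\<gamma> - \<alpha>) * ((?C t)\<^sup>2 - (?S t)\<^sup>2) - 4 * \<beta> * ?S t * ?C t))" for t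
  have c: "c t = (fst (circ t), snd (circ t), quad \<alpha> \<beta> \<gamma> \<delta> (circ t))" for t
    by (simp add: c_def circ_def)
  show ?thesis
    unfolding closed_C2_curve_def
  proof (rule exI[of _ c], rule exI[of _ c'], rule exI[of _ c''], intro conjI allI)
    have "range c = (\<lambda>P. (fst P, snd P, quad \<alpha> \<beta> \<gamma> \<delta> P)) ` range circ"
      by (simp add: c image_image)
    moreover have "(\<lambda>P. (fst P, snd P, f P)) ` A = {(x, y, f (x, y)) | x y. (x, y) \<in> A}"
      for f :: "plane \<Rightarrow> real" and A
      by force
    ultimately show "range c = {(x, y, quad \<alpha> \<beta> \<gamma> \<delta> (x, y)) | x y. (x, y) \<in> sphere 0 1}"
      by (simp only: range_circ)
    show "c (t + 1) = c t" for t
      by (simp add: c circ_add_1)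
    show "inj_on c {0..<1}"
      using inj_on_circ by (auto simp: inj_on_def c prod_eq_iff)
    have C: "(?C has_real_derivative - (2 * pi) * ?S t) (at t)" for t
      by (auto intro!: derivative_eq_intros)
    have S: "(?S has_real_derivative 2 * pi * ?C t) (at t)" for t
      by (auto intro!: derivative_eq_intros)
    have "((\<lambda>t. quad \<alpha> \<beta> \<gamma> \<delta> (?C t, ?S t)) has_real_derivative snd (snd (c' t))) (at t)" for t
      unfolding quad_def prod.case
      by (rule derivative_eq_intros C S refl)+
        (simp add: c'_def algebra_simps power2_eq_square)
    then show "(c has_vector_derivative c' t) (at t)" for t
      using C S unfolding c_def c'_def has_real_derivative_iff_has_vector_derivative
      by (auto intro!: has_vector_derivative_Pair)
    have "((\<lambda>t. snd (snd (c' t))) has_real_derivative snd (snd (c'' t))) (at t)" for t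
      unfolding c'_def snd_conv
      by (rule derivative_eq_intros C S refl)+
        (simp add: c''_def algebra_simps power2_eq_square)
    moreover have "((\<lambda>t. - (2 * pi) * ?S t) has_real_derivative - (2 * pi)\<^sup>2 * ?C t) (at t)" for t
      by (rule derivative_eq_intros C S refl)+ (simp add: power2_eq_square)
    moreover have "((\<lambda>t. 2 * pi * ?C t) has_real_derivative - (2 * pi)\<^sup>2 * ?S t) (at t)" for t
      by (rule derivative_eq_intros C S refl)+ (simp add: power2_eq_square)
    ultimately show "(c' has_vector_derivative c'' t) (at t)" for t
      unfolding c'_def c''_def has_real_derivative_iff_has_vector_derivative snd_conv
      by (intro has_vector_derivative_Pair) auto
    show "continuous_on UNIV c''"
      unfolding c''_def by (intro continuous_intros)
    \<comment> \<open>The first two components suffice: sine and cosine have no common zero.\<close>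
    show "c' t \<noteq> 0" for t
      using sin_zero_norm_cos_one[of "2 * pi * t"] by (auto simp: c'_def zero_prod_def)
  qed
qed

text \<open>The factor \<open>\<sigma>\<close> carries the sign convention. The second function
  minus the first is \<open>\<sigma> * (1 - x\<^sup>2 - y\<^sup>2)\<close>, which vanishes on the
  unit circle and equals \<open>\<sigma>\<close> at the origin. The first function also serves as
  \<open>\<phi>\<close>.\<close>

lemma nonuniqueness_quad:
  assumes "\<sigma> \<noteq> 0" "\<And>P. eqn (quad 0 \<sigma> \<sigma> 0) P" "\<And>P. eqn (quad (- \<sigma>) \<sigma> 0 \<sigma>) P"
  shows "\<exists>\<Omega> \<gamma> \<phi> u1 u2. region_bounded_by \<Omega> \<gamma> \<and>
    closed_C2_curve {(x, y, \<phi> (x, y)) | x y. (x, y) \<in> \<gamma>} \<and>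
    solves_dirichlet eqn \<Omega> \<gamma> \<phi> u1 \<and> solves_dirichlet eqn \<Omega> \<gamma> \<phi> u2 \<and>
    (\<exists>P \<in> closure \<Omega>. u1 P \<noteq> u2 P)"
proof -
  have "quad (- \<sigma>) \<sigma> 0 \<sigma> P = quad 0 \<sigma> \<sigma> 0 P" if "P \<in> sphere 0 1" for P
  proof -
    obtain x y where P: "P = (x, y)" by fastforce
    then have "x\<^sup>2 + y\<^sup>2 = 1" using that in_sphere_plane by simp
    then have "\<sigma> * (x\<^sup>2 + y\<^sup>2) = \<sigma>" by simp
    then show ?thesis by (simp add: P quad_def algebra_simps)
  qed
  then have "solves_dirichlet eqn (ball 0 1) (sphere 0 1) (quad 0 \<sigma> \<sigma> 0) (quad (- \<sigma>) \<sigma> 0 \<sigma>)"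
    "solves_dirichlet eqn (ball 0 1) (sphere 0 1) (quad 0 \<sigma> \<sigma> 0) (quad 0 \<sigma> \<sigma> 0)"
    using assms by (simp_all add: solves_dirichlet_def smooth_on_quad continuous_on_quad)
  moreover have "quad 0 \<sigma> \<sigma> 0 0 \<noteq> quad (- \<sigma>) \<sigma> 0 \<sigma> 0"
    using assms(1) by (simp add: quad_def zero_prod_def)
  moreover have "(0 :: plane) \<in> closure (ball 0 1)" by simp
  ultimately show ?thesis
    using region_bounded_by_circle closed_C2_curve_quad_over_circle by blast
qed

theorem theorem3:
  "\<forall>eqn \<in> {minimal_surface_eq, minimal_surface_eq_planar}.
     \<exists>(\<Omega> :: plane set) (\<gamma> :: plane set) (\<phi> :: plane \<Rightarrow> real) (u1 :: plane \<Rightarrow> real) (u2 :: plane \<Rightarrow> real).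
       region_bounded_by \<Omega> \<gamma> \<and>
       closed_C2_curve {(x, y, \<phi> (x, y)) | x y. (x, y) \<in> \<gamma>} \<and>
       solves_dirichlet eqn \<Omega> \<gamma> \<phi> u1 \<and>
       solves_dirichlet eqn \<Omega> \<gamma> \<phi> u2 \<and>
       (\<exists>P \<in> closure \<Omega>. u1 P \<noteq> u2 P)"
proof (intro ballI)
  fix eqn :: "(plane \<Rightarrow> real) \<Rightarrow> plane \<Rightarrow> bool"
  assume "eqn \<in> {minimal_surface_eq, minimal_surface_eq_planar}"
  then consider "eqn = minimal_surface_eq" | "eqn = minimal_surface_eq_planar" by blast
  then show "\<exists>\<Omega> \<gamma> \<phi> u1 u2. region_bounded_by \<Omega> \<gamma> \<and>
    closed_C2_curve {(x, y, \<phi> (x, y)) | x y. (x, y) \<in> \<gamma>} \<and>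
    solves_dirichlet eqn \<Omega> \<gamma> \<phi> u1 \<and> solves_dirichlet eqn \<Omega> \<gamma> \<phi> u2 \<and>
    (\<exists>P \<in> closure \<Omega>. u1 P \<noteq> u2 P)"
  proof cases
    case 1
    \<comment> \<open>The instantiated values are \<open>a\<close>, \<open>l\<close>,
      \<open>m\<close>, \<open>b\<close> in this order. The horizontal gradients are
      \<open>(- 2 * x - 2 * y) *\<^sub>R (0, 1)\<close> and
      \<open>(2 * x) *\<^sub>R (1, - 1)\<close>.\<close>
    show ?thesis
      unfolding 1
      by (rule nonuniqueness_quad[of "- 1"])
        (simp, (rule minimal_surface_eq_quad[of _ 0 "- 2" _ "- 2" 1]
          minimal_surface_eq_quad[of _ 1 2 _ 0 "- 1"]; simp; fail)+)
  next
    case 2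
    \<comment> \<open>Here \<open>(p, q)\<close> is \<open>(2 * x + 2 * y) *\<^sub>R (0, 1)\<close>
      for the first function and \<open>(2 * x) *\<^sub>R (- 1, 1)\<close> for the second.\<close>
    show ?thesis
      unfolding 2
      by (rule nonuniqueness_quad[of 1])
        (simp, (rule minimal_surface_eq_planar_quad[of _ 0 2 _ 2 1]
          minimal_surface_eq_planar_quad[of _ "- 1" 2 _ 0 1]; simp; fail)+)
  qed
qed

end
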